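(* Let $n,d>0$ be integers, and let $P=(0,p_1,\ldots,p_n)$ be a configuration of $n+1$ points in $\mathbb{R}^d$. The following two conditions are equivalent. 1. $P$ is a rich configuration. 2. $G(P)$ is dense in $\mathbb{R}^d$.
   Context: There are $n+1$ labeled pointlike particles, numbered $0,1,\ldots,n$, in $\mathbb{R}^d$. A configuration is a sequence $(p_0,p_1,\ldots,p_n)$ of points of $\mathbb{R}^d$, where $p_i$ is the position of particle $i$; different particles are allowed to occupy the same point. A legal move consists of choosing two different particles $i\neq j$, at current positions $p_i'$ and $p_j'$, and moving particle $i$ from $p_i'$ to $2p_j'-p_i'$, all other particles staying in place. Any particle, including particle $0$, may move. A configuration is reachable from $(p_0,\ldots,p_n)$ if it can be obtained from it by a finite sequence of legal moves. A configuration $(p_0,\ldots,p_n)$ is rich if the set of all configurations reachable from it is dense in $\mathbb{R}^d\times\cdots\times\mathbb{R}^d=\mathbb{R}^{d(n+1)}$; that is, for all $q_0,\ldots,q_n\in\mathbb{R}^d$ and every $\varepsilon>0$ there is a finite sequence of legal moves that takes the particle starting at $p_i$ to a position at Euclidean distance at most $\varepsilon$ from $q_i$, simultaneously for all $0\le i\le n$. A configuration $(0,p_1,\ldots,p_n)$ with $p_0=0$ is identified with the $d\times n$ real matrix $P=(p_1\;p_2\;\cdots\;p_n)$ with columns $p_1,\ldots,p_n$, and $G(P)$ denotes the additive subgroup of $\mathbb{R}^d$ generated by $p_1,\ldots,p_n$, i.e. $G(P)=\{Pv\mid v\in\mathbb{Z}^n\}$. *)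

theory Defs
  imports "HOL-Analysis.Analysis" "HOL-Computational_Algebra.Group_Closure"
begin

text \<open>A configuration of the particles \<open>0, \<dots>, n\<close> is a function on \<open>nat\<close>; only its values on
  \<open>{0..n}\<close> matter. Moves leave the values beyond \<open>n\<close> unchanged.\<close>

definition legal_move :: "nat \<Rightarrow> (nat \<Rightarrow> real ^ 'd) \<Rightarrow> (nat \<Rightarrow> real ^ 'd) \<Rightarrow> bool" where
  "legal_move n p q \<longleftrightarrow>
     (\<exists>i\<in>{0..n}. \<exists>j\<in>{0..n}. i \<noteq> j \<and> q = p(i := 2 *\<^sub>R p j - p i))"

definition reachable :: "nat \<Rightarrow> (nat \<Rightarrow> real ^ 'd) \<Rightarrow> (nat \<Rightarrow> real ^ 'd) \<Rightarrow> bool" where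
  "reachable n = (legal_move n)\<^sup>*\<^sup>*"

definition rich :: "nat \<Rightarrow> (nat \<Rightarrow> real ^ 'd) \<Rightarrow> bool" where
  "rich n p \<longleftrightarrow>
     (\<forall>q :: nat \<Rightarrow> real ^ 'd. \<forall>\<epsilon>>0. \<exists>p'. reachable n p p' \<and> (\<forall>i\<in>{0..n}. dist (p' i) (q i) \<le> \<epsilon>))"

definition G :: "nat \<Rightarrow> (nat \<Rightarrow> real ^ 'd) \<Rightarrow> (real ^ 'd) set" where
  "G n p = group_closure (p ` {1..n})"

lemma G_eq_integer_combinations:
  "G n p = {(\<Sum>i=1..n. of_int (v i) *\<^sub>R p i) | v :: nat \<Rightarrow> int. True}" (is "_ = ?R")
proof
  show "G n p \<subseteq> ?R"
  proof
    fix x assume "x \<in> G n p"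
    then have "x \<in> group_closure (p ` {1..n})" by (simp add: G_def)
    then show "x \<in> ?R"
    proof (induction rule: group_closure.induct)
      case (base s)
      then consider "s = 0" | k where "k \<in> {1..n}" "s = p k" by auto
      then show ?case
      proof cases
        case 1
        then show ?thesis by (intro CollectI exI[of _ "\<lambda>_. 0"]) simp
      next
        case 2
        have "(\<Sum>i=1..n. of_int (if i = k then 1 else 0) *\<^sub>R p i)
            = (\<Sum>i=1..n. if i = k then p i else 0)"
          by (rule sum.cong) auto
        also have "\<dots> = s" using 2 by simp
        finally show ?thesis by (intro CollectI exI[of _ "\<lambda>i. if i = k then 1 else 0"]) simp
      qed
    next
      case (diff s t)
      then obtain v w :: "nat \<Rightarrow> int" where "s = (\<Sum>i=1..n. of_int (v i) *\<^sub>R p i)"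
        "t = (\<Sum>i=1..n. of_int (w i) *\<^sub>R p i)" by blast
      then show ?case
        by (intro CollectI exI[of _ "\<lambda>i. v i - w i"]) (simp add: sum_subtractf scaleR_diff_left)
    qed
  qed
  have nat_mult: "real m *\<^sub>R x \<in> group_closure (p ` {1..n})"
    if "x \<in> group_closure (p ` {1..n})" for m x
    using that by (induction m) (auto simp: scaleR_add_left intro: group_closure_add)
  have int_mult: "real_of_int k *\<^sub>R x \<in> group_closure (p ` {1..n})"
    if "x \<in> group_closure (p ` {1..n})" for k x
    using nat_mult[OF that] by (cases k rule: int_cases2) auto
  have sum_closed: "(\<Sum>i\<in>I. f i) \<in> group_closure (p ` {1..n})"
    if "finite I" "\<And>i. i \<in> I \<Longrightarrow> f i \<in> group_closure (p ` {1..n})" for I :: "nat set" and f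
    using that by (induction I rule: finite_induct) (auto intro: group_closure_add)
  show "?R \<subseteq> G n p"
  proof
    fix x assume "x \<in> ?R"
    then obtain v :: "nat \<Rightarrow> int" where x: "x = (\<Sum>i=1..n. of_int (v i) *\<^sub>R p i)" by blast
    show "x \<in> G n p"
      unfolding G_def x by (intro sum_closed int_mult group_closure.base) simp_all
  qed
qed

end

theory Submission
  imports Defs
begin

section \<open>Even shears of families of vectors\<close>

text \<open>Moves yield only even multiples, so the vector at \<open>a\<close> never leaves its
  class modulo twice the generated group. Its odd multiples are combinations with an odd coefficient
  at \<open>a\<close> and even ones elsewhere, so only combinations of this parity pattern are
  collected. Two facts show that enough of them exist. A dense group stays dense after doubling and
  translating, so the given vectors have such combinations that are arbitrarily short. Any real
  linear relation among the target vectors becomes, after a small change of the targets, an integer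
  relation of this pattern; as shears are invertible, collecting it on the target side is as good as
  collecting on the side of the given vectors. A growing subspace \<open>S\<close> stands in for
  successive quotient spaces, so that the induction stays in one type.\<close>

definition shear :: "nat set \<Rightarrow> (nat \<Rightarrow> 'a::real_vector) \<Rightarrow> (nat \<Rightarrow> 'a) \<Rightarrow> bool" where
  "shear I p p' \<longleftrightarrow>
     (\<exists>i\<in>I. \<exists>j\<in>I. \<exists>c::int. i \<noteq> j \<and> p' = p(i := p i + of_int (2 * c) *\<^sub>R p j))"

lemma shear_sym:
  assumes "shear I p p'" shows "shear I p' p"
proof -
  obtain i j c where *: "i \<in> I" "j \<in> I" "i \<noteq> j" "p' = p(i := p i + of_int (2 * c) *\<^sub>R p j)"
    using assms unfolding shear_def by blast
  have "p = p'(i := p' i + of_int (2 * - c) *\<^sub>R p' j)"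
    using * by (auto simp: fun_eq_iff)
  then show ?thesis using * unfolding shear_def by blast
qed

lemma shears_mono:
  assumes "(shear I)\<^sup>*\<^sup>* p p'" "I \<subseteq> J" shows "(shear J)\<^sup>*\<^sup>* p p'"
proof -
  have "shear I \<le> shear J" using assms(2) unfolding shear_def by blast
  then show ?thesis using assms(1) rtranclp_mono by blast
qed

lemma shears_unchanged:
  assumes "(shear I)\<^sup>*\<^sup>* p p'" "k \<notin> I" shows "p' k = p k"
  using assms by (induction rule: rtranclp_induct) (auto simp: shear_def)

text \<open>Shears act on coefficients by the dual rule, with \<open>i\<close> and \<open>j\<close>
  exchanged: the added \<open>2 * c\<close> copies of \<open>p j\<close> are paid for by the
  coefficient at \<open>j\<close>. A shear of the vectors thus performs a division step on the
  coefficients.\<close>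

lemma sum_coeff_shear:
  fixes p :: "nat \<Rightarrow> 'a::real_vector" and v :: "nat \<Rightarrow> int"
  assumes "finite I" "i \<in> I" "j \<in> I" "i \<noteq> j"
  shows "(\<Sum>k\<in>I. of_int ((v(j := v j - 2 * c * v i)) k) *\<^sub>R (p(i := p i + of_int (2 * c) *\<^sub>R p j)) k)
       = (\<Sum>k\<in>I. of_int (v k) *\<^sub>R p k)"
proof -
  have split: "(\<Sum>k\<in>I. f k) = f i + f j + (\<Sum>k\<in>I - {i, j}. f k)" for f :: "nat \<Rightarrow> 'a"
  proof -
    have "I - {i} - {j} = I - {i, j}" by auto
    then show ?thesis
      using assms sum.remove[of I i f] sum.remove[of "I - {i}" j f] by (simp add: add.assoc)
  qed
  show ?thesis
    unfolding split using assms(4)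
    by (simp add: algebra_simps)
qed

lemma shears_along:
  fixes p :: "nat \<Rightarrow> 'a::real_vector" and m :: "nat \<Rightarrow> int"
  assumes "finite J" "J \<subseteq> I - {j}" "j \<in> I"
  shows "(shear I)\<^sup>*\<^sup>* p (\<lambda>i. if i \<in> J then p i + of_int (2 * m i) *\<^sub>R p j else p i)"
  using assms(1,2)
proof (induction J rule: finite_induct)
  case (insert k J)
  let ?p = "\<lambda>J i. if i \<in> J then p i + of_int (2 * m i) *\<^sub>R p j else p i"
  have "?p (insert k J) = (?p J)(k := ?p J k + of_int (2 * m k) *\<^sub>R ?p J j)"
    using insert.hyps insert.prems by (auto simp: fun_eq_iff)
  then have "shear I (?p J) (?p (insert k J))"
    using insert.prems assms(3) unfolding shear_def by blast
  with insert show ?case by (meson insert_subset rtranclp.rtrancl_into_rtrancl)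
qed simp

text \<open>The Euclidean algorithm with even quotients on the coefficients. Parity rules out a tie
  between the coefficient at \<open>a\<close> and any other nonzero coefficient, so it only stops when the
  coefficient at \<open>a\<close> is the last one left.\<close>

lemma shears_collect_combination:
  fixes p :: "nat \<Rightarrow> 'a::real_vector" and v :: "nat \<Rightarrow> int"
  assumes "finite I" "a \<in> I" "odd (v a)" "\<forall>i\<in>I. i \<noteq> a \<longrightarrow> even (v i)"
  obtains p' g where "(shear I)\<^sup>*\<^sup>* p p'" "g \<noteq> 0"
    "of_int g *\<^sub>R p' a = (\<Sum>i\<in>I. of_int (v i) *\<^sub>R p i)"
proof -
  have "\<exists>p' g. (shear I)\<^sup>*\<^sup>* p p' \<and> g \<noteq> (0::int) \<and>
      of_int g *\<^sub>R p' a = (\<Sum>i\<in>I. of_int (v i) *\<^sub>R p i)"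
    using assms(3,4)
  proof (induction "\<Sum>i\<in>I. nat \<bar>v i\<bar>" arbitrary: v p rule: less_induct)
    case less
    have step: ?case
      if ij: "i \<in> I" "j \<in> I" "i \<noteq> j" and "\<bar>v j - 2 * c * v i\<bar> < \<bar>v j\<bar>"
        and par: "j = a \<or> even (v j)" for i j c
    proof -
      define w where "w = v(j := v j - 2 * c * v i)"
      define r where "r = p(i := p i + of_int (2 * c) *\<^sub>R p j)"
      have "(\<Sum>i\<in>I. nat \<bar>w i\<bar>) < (\<Sum>i\<in>I. nat \<bar>v i\<bar>)"
        using assms(1) that by (intro sum_strict_mono_ex1) (auto simp: w_def)
      moreover have "odd (w a)" "\<forall>i\<in>I. i \<noteq> a \<longrightarrow> even (w i)"
        using less.prems by (auto simp: w_def)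
      ultimately obtain p' g where "(shear I)\<^sup>*\<^sup>* r p'" "g \<noteq> (0::int)"
          "of_int g *\<^sub>R p' a = (\<Sum>i\<in>I. of_int (w i) *\<^sub>R r i)"
        using less.hyps by blast
      moreover have "(\<Sum>i\<in>I. of_int (w i) *\<^sub>R r i) = (\<Sum>i\<in>I. of_int (v i) *\<^sub>R p i)"
        unfolding w_def r_def using sum_coeff_shear[OF assms(1) ij] .
      moreover have "shear I p r" unfolding shear_def r_def using ij by blast
      ultimately show ?thesis by (metis converse_rtranclp_into_rtranclp)
    qed
    show ?case
    proof (cases "\<exists>k\<in>I. k \<noteq> a \<and> v k \<noteq> 0")
      case True
      then obtain k where k: "k \<in> I" "k \<noteq> a" "v k \<noteq> 0" by blast
      have ev: "even (v k)" and od: "odd (v a)" using less.prems k by auto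
      then have "\<bar>v k\<bar> \<noteq> \<bar>v a\<bar>" by (metis even_abs_add_iff add.right_neutral)
      then consider "\<bar>v k\<bar> < \<bar>v a\<bar>" | "\<bar>v a\<bar> < \<bar>v k\<bar>" by linarith
      then show ?thesis
      proof cases
        case 1
        \<comment> \<open>The signs make the new absolute value equal to
          \<open>\<bar>\<bar>v a\<bar> - 2 * \<bar>v k\<bar>\<bar>\<close>, which is below
          \<open>\<bar>v a\<bar>\<close> because
          \<open>0 < \<bar>v k\<bar> < \<bar>v a\<bar>\<close>.\<close>
        then have "\<bar>v a - 2 * (sgn (v a) * sgn (v k)) * v k\<bar> < \<bar>v a\<bar>"
          using k(3) by (auto simp: sgn_if split: if_splits)
        then show ?thesis using step k assms(2) by blast
      next
        case 2
        then have "\<bar>v k - 2 * (sgn (v a) * sgn (v k)) * v a\<bar> < \<bar>v k\<bar>"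
          using od by (auto simp: sgn_if split: if_splits)
        then show ?thesis using step k assms(2) ev by blast
      qed
    next
      case False
      then have "(\<Sum>i\<in>I. of_int (v i) *\<^sub>R p i) = (\<Sum>i\<in>I. if i = a then of_int (v a) *\<^sub>R p a else 0)"
        by (intro sum.cong) auto
      also have "\<dots> = of_int (v a) *\<^sub>R p a" using assms(1,2) by simp
      finally show ?thesis using less.prems(1) by (metis even_zero rtranclp.rtrancl_refl)
    qed
  qed
  then show ?thesis using that by blast
qed

section \<open>Orbits and integer combinations modulo a subspace\<close>

text \<open>Density of the generated group in the quotient by \<open>S\<close>, written with
  representatives; \<open>S = {0}\<close> gives density in the space itself.\<close>

definition dense_mod :: "nat set \<Rightarrow> 'a::real_normed_vector set \<Rightarrow> (nat \<Rightarrow> 'a) \<Rightarrow> bool" where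
  "dense_mod I S p \<longleftrightarrow> (\<forall>x. \<forall>e>0. \<exists>v::nat \<Rightarrow> int. \<exists>s\<in>S.
     norm ((\<Sum>i\<in>I. of_int (v i) *\<^sub>R p i) + s - x) < e)"

definition approx_mod ::
    "nat set \<Rightarrow> 'a::real_normed_vector set \<Rightarrow> (nat \<Rightarrow> 'a) \<Rightarrow> (nat \<Rightarrow> 'a) \<Rightarrow> bool" where
  "approx_mod I S p q \<longleftrightarrow> (\<forall>e>0. \<exists>p'. (shear I)\<^sup>*\<^sup>* p p' \<and>
     (\<forall>i\<in>I. \<exists>s\<in>S. norm (p' i - q i - s) < e))"

lemma dense_mod_shears:
  assumes "(shear I)\<^sup>*\<^sup>* p p'" "dense_mod I S p" "finite I"
  shows "dense_mod I S p'"
  using assms(1)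
proof (induction rule: rtranclp_induct)
  case base
  then show ?case using assms by simp
next
  case (step y z)
  then obtain i j c where *: "i \<in> I" "j \<in> I" "i \<noteq> j" "z = y(i := y i + of_int (2 * c) *\<^sub>R y j)"
    unfolding shear_def by blast
  show ?case
    using step.IH sum_coeff_shear[OF assms(3) *(1-3), of _ c y] unfolding dense_mod_def *(4)
    by metis
qed

text \<open>A shear is continuous and respects \<open>S\<close>, hence maps the orbit closure into
  itself. It enlarges errors by a factor of at most \<open>1 + \<bar>t\<bar>\<close>, which dictates
  \<open>d\<close>.\<close>

lemma approx_mod_shear:
  fixes p :: "nat \<Rightarrow> 'a::real_normed_vector"
  assumes S: "subspace S" and "approx_mod I S p q" "shear I q q'"
  shows "approx_mod I S p q'"
  unfolding approx_mod_def
proof (intro allI impI)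
  fix e :: real assume "e > 0"
  obtain i j c where ij: "i \<in> I" "j \<in> I" "i \<noteq> j" and q': "q' = q(i := q i + of_int (2 * c) *\<^sub>R q j)"
    using assms(3) unfolding shear_def by blast
  define t :: real where "t = of_int (2 * c)"
  define d where "d = e / (1 + \<bar>t\<bar>)"
  have "d > 0" using \<open>e > 0\<close> unfolding d_def by (intro divide_pos_pos) auto
  then obtain r where r: "(shear I)\<^sup>*\<^sup>* p r" "\<forall>i\<in>I. \<exists>s\<in>S. norm (r i - q i - s) < d"
    using assms(2) unfolding approx_mod_def by blast
  define r' where "r' = r(i := r i + t *\<^sub>R r j)"
  have "shear I r r'" unfolding shear_def r'_def t_def using ij by blast
  moreover have "\<exists>s\<in>S. norm (r' k - q' k - s) < e" if k: "k \<in> I" for k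
  proof (cases "k = i")
    case True
    obtain s s' where s: "s \<in> S" "norm (r i - q i - s) < d" "s' \<in> S" "norm (r j - q j - s') < d"
      using r(2) ij by meson
    have "r' k - q' k - (s + t *\<^sub>R s') = (r i - q i - s) + t *\<^sub>R (r j - q j - s')"
      unfolding True r'_def q' t_def[symmetric] by (simp add: algebra_simps)
    then have "norm (r' k - q' k - (s + t *\<^sub>R s')) \<le> norm (r i - q i - s) + \<bar>t\<bar> * norm (r j - q j - s')"
      by (metis norm_scaleR norm_triangle_ineq)
    also have "\<dots> < d + \<bar>t\<bar> * d"
      using s by (intro add_less_le_mono mult_left_mono) auto
    also have "\<dots> = e" unfolding d_def by (simp add: field_simps add_nonneg_eq_0_iff)
    finally show ?thesis using S s by (metis subspace_add subspace_scale)
  next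
    case False
    have "d \<le> e" using \<open>e > 0\<close> unfolding d_def by (simp add: field_simps)
    moreover obtain s where "s \<in> S" "norm (r k - q k - s) < d" using r(2) k by blast
    ultimately show ?thesis using False unfolding r'_def q' by (intro bexI[of _ s]) auto
  qed
  ultimately show "\<exists>p'. (shear I)\<^sup>*\<^sup>* p p' \<and> (\<forall>i\<in>I. \<exists>s\<in>S. norm (p' i - q' i - s) < e)"
    using r(1) by (meson rtranclp.rtrancl_into_rtrancl)
qed

text \<open>Since shears are invertible, a target may be replaced by any member of its own
  orbit.\<close>

lemma approx_mod_pullback:
  assumes "subspace S" "(shear I)\<^sup>*\<^sup>* q q'" "approx_mod I S p q'"
  shows "approx_mod I S p q"
  using assms(2,3)
  by (induction rule: rtranclp_induct) (auto intro: approx_mod_shear[OF assms(1)] shear_sym)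

lemma approx_mod_closed:
  assumes "\<And>e. e > 0 \<Longrightarrow> \<exists>q'. approx_mod I S p q' \<and> (\<forall>i\<in>I. norm (q' i - q i) < e)"
  shows "approx_mod I S p q"
  unfolding approx_mod_def
proof (intro allI impI)
  fix e :: real assume "e > 0"
  then have half: "e / 2 > 0" by simp
  obtain q' where q': "approx_mod I S p q'" "\<forall>i\<in>I. norm (q' i - q i) < e / 2"
    using assms[OF half] by blast
  obtain r where r: "(shear I)\<^sup>*\<^sup>* p r" "\<forall>i\<in>I. \<exists>s\<in>S. norm (r i - q' i - s) < e / 2"
    using q'(1)[unfolded approx_mod_def, rule_format, OF half] by blast
  have "\<exists>s\<in>S. norm (r i - q i - s) < e" if i: "i \<in> I" for i
  proof -
    obtain s where s: "s \<in> S" "norm (r i - q' i - s) < e / 2"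
      using r(2) i by blast
    have "r i - q i - s = (r i - q' i - s) + (q' i - q i)" by simp
    moreover have "norm (r i - q' i - s) + norm (q' i - q i) < e" using s(2) q'(2) i by fastforce
    ultimately have "norm (r i - q i - s) < e" by (metis norm_triangle_lt)
    then show ?thesis using s(1) by blast
  qed
  then show "\<exists>p'. (shear I)\<^sup>*\<^sup>* p p' \<and> (\<forall>i\<in>I. \<exists>s\<in>S. norm (p' i - q i - s) < e)"
    using r(1) by blast
qed

section \<open>Short odd combinations and odd relations modulo a subspace\<close>

text \<open>Doubling a combination close to \<open>(x - p a) / 2\<close> modulo \<open>S\<close> and
  adding \<open>p a\<close> gives the parity pattern and lands near \<open>x\<close>. Here
  \<open>x\<close> is short but outside \<open>S\<close>: the combination must be small modulo
  \<open>S\<close> and still raise the dimension when adjoined.\<close>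

lemma dense_mod_odd_combination:
  fixes p :: "nat \<Rightarrow> 'a::euclidean_space"
  assumes "dense_mod I S p" and S: "subspace S" "S \<noteq> UNIV" and I: "finite I" "a \<in> I" and "e > 0"
  obtains v s where "odd (v a)" "\<forall>i\<in>I. i \<noteq> a \<longrightarrow> even (v i)" "s \<in> S"
    "norm ((\<Sum>i\<in>I. of_int (v i) *\<^sub>R p i) - s) < e" "(\<Sum>i\<in>I. of_int (v i) *\<^sub>R p i) \<notin> S"
proof -
  obtain y where "y \<notin> S" using S by auto
  then have "y \<noteq> 0" using S subspace_0 by blast
  define x where "x = (e / (2 * norm y)) *\<^sub>R y"
  have "norm x = e / 2" using \<open>e > 0\<close> \<open>y \<noteq> 0\<close> unfolding x_def by simp
  have "y = (2 * norm y / e) *\<^sub>R x" using \<open>e > 0\<close> \<open>y \<noteq> 0\<close> unfolding x_def by simp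
  then have "x \<notin> S" using \<open>y \<notin> S\<close> S(1) by (metis subspace_scale)
  then obtain d where d: "d > 0" "ball x d \<subseteq> - S"
    using closed_subspace[OF S(1)] by (metis ComplI open_Compl open_contains_ball)
  \<comment> \<open>The bound \<open>d\<close> keeps the combination off \<open>S\<close>, the bound
    \<open>e / 2\<close> keeps it short; halving \<open>f\<close> below makes up for the
    doubling.\<close>
  define f where "f = min d (e / 2)"
  have "f / 2 > 0" using d \<open>e > 0\<close> by (simp add: f_def)
  then obtain v :: "nat \<Rightarrow> int" and s
    where s: "s \<in> S" and close: "norm ((\<Sum>i\<in>I. of_int (v i) *\<^sub>R p i) + s - (1/2) *\<^sub>R (x - p a)) < f / 2"
    using assms(1) unfolding dense_mod_def by blast
  define w where "w i = 2 * v i + (if i = a then 1 else 0)" for i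
  define z where "z = (\<Sum>i\<in>I. of_int (w i) *\<^sub>R p i)"
  have "z = (\<Sum>i\<in>I. 2 *\<^sub>R of_int (v i) *\<^sub>R p i + (if i = a then p a else 0))"
    unfolding z_def by (intro sum.cong) (auto simp: w_def scaleR_add_left)
  also have "\<dots> = 2 *\<^sub>R (\<Sum>i\<in>I. of_int (v i) *\<^sub>R p i) + p a"
    using I by (simp add: sum.distrib scaleR_sum_right)
  finally have "z + 2 *\<^sub>R s - x = 2 *\<^sub>R ((\<Sum>i\<in>I. of_int (v i) *\<^sub>R p i) + s - (1/2) *\<^sub>R (x - p a))"
    by (simp add: algebra_simps)
  then have near: "norm (z + 2 *\<^sub>R s - x) < f" using close by (simp only: norm_scaleR)
  have "z + 2 *\<^sub>R s \<in> ball x d" using near by (simp add: f_def dist_norm norm_minus_commute)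
  then have "z + 2 *\<^sub>R s \<notin> S" using d(2) by blast
  then have "z \<notin> S" using s S(1) by (metis subspace_add subspace_scale)
  have "norm (z + 2 *\<^sub>R s) \<le> norm (z + 2 *\<^sub>R s - x) + norm x" by (metis norm_triangle_sub add.commute)
  also have "\<dots> < e" using near \<open>norm x = e / 2\<close> by (simp add: f_def)
  finally have "norm (z - (-2) *\<^sub>R s) < e" by simp
  moreover have "(-2) *\<^sub>R s \<in> S" using s S(1) by (simp add: subspace_scale subspace_neg)
  moreover have "odd (w a)" "\<forall>i\<in>I. i \<noteq> a \<longrightarrow> even (w i)" by (auto simp: w_def)
  ultimately show ?thesis using that \<open>z \<notin> S\<close> unfolding z_def by blast
qed

text \<open>Dimension count: starting from \<open>S\<close>, each further vector either produces a
  relation or raises the dimension of \<open>W J\<close>. Relations are indexed by \<open>I\<close>,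
  so repeated vectors count separately. The coefficient 1 at \<open>k\<close> marks the one that
  becomes large after scaling.\<close>

lemma linear_relation_mod:
  fixes q :: "nat \<Rightarrow> 'a::euclidean_space"
  assumes S: "subspace S" and "finite I" and "DIM('a) < dim S + card I"
  obtains c k where "k \<in> I" "c k = (1::real)" "(\<Sum>i\<in>I. c i *\<^sub>R q i) \<in> S"
proof -
  define W where "W J = {s + (\<Sum>i\<in>J. c i *\<^sub>R q i) | s c. s \<in> S}" for J
  have sub: "subspace (W J)" for J
    unfolding subspace_def
  proof (intro conjI ballI allI)
    show "0 \<in> W J" unfolding W_def using subspace_0[OF S] by (force intro: exI[of _ "\<lambda>_. 0"])
  next
    fix x y assume "x \<in> W J" "y \<in> W J"
    then obtain s c s' c' where *: "s \<in> S" "s' \<in> S" "x = s + (\<Sum>i\<in>J. c i *\<^sub>R q i)"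
        "y = s' + (\<Sum>i\<in>J. c' i *\<^sub>R q i)" unfolding W_def by blast
    have "x + y = (s + s') + (\<Sum>i\<in>J. (c i + c' i) *\<^sub>R q i)"
      unfolding * by (simp add: scaleR_add_left sum.distrib)
    then show "x + y \<in> W J"
      unfolding W_def using subspace_add[OF S *(1,2)]
      by (intro CollectI exI[of _ "s + s'"] exI[of _ "\<lambda>i. c i + c' i"]) simp
  next
    fix t x assume "x \<in> W J"
    then obtain s c where *: "s \<in> S" "x = s + (\<Sum>i\<in>J. c i *\<^sub>R q i)" unfolding W_def by blast
    have "t *\<^sub>R x = t *\<^sub>R s + (\<Sum>i\<in>J. (t * c i) *\<^sub>R q i)"
      unfolding * by (simp add: scaleR_add_right scaleR_sum_right)
    then show "t *\<^sub>R x \<in> W J"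
      unfolding W_def using subspace_scale[OF S *(1), of t]
      by (intro CollectI exI[of _ "t *\<^sub>R s"] exI[of _ "\<lambda>i. t * c i"]) simp
  qed
  have "(\<exists>c k. k \<in> J \<and> c k = 1 \<and> (\<Sum>i\<in>J. c i *\<^sub>R q i) \<in> S) \<or> dim S + card J \<le> dim (W J)"
    if "finite J" for J
    using that
  proof (induction J rule: finite_induct)
    case empty
    then show ?case by (simp add: W_def)
  next
    case (insert a J)
    have upd: "(\<Sum>i\<in>J. (c(a := t)) i *\<^sub>R q i) = (\<Sum>i\<in>J. c i *\<^sub>R q i)" for c t
      using insert.hyps by (intro sum.cong) auto
    consider (rel) c k where "k \<in> J" "c k = 1" "(\<Sum>i\<in>J. c i *\<^sub>R q i) \<in> S"
      | (new) "q a \<in> W J" | (dim) "dim S + card J \<le> dim (W J)" "q a \<notin> W J"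
      using insert.IH by blast
    then show ?case
    proof cases
      case rel
      have "(\<Sum>i\<in>insert a J. (c(a := 0)) i *\<^sub>R q i) \<in> S"
        using rel insert.hyps upd[of c 0] by simp
      then show ?thesis using rel insert.hyps
        by (intro disjI1 exI[of _ "c(a := 0)"] exI[of _ k]) auto
    next
      case new
      then obtain s c where *: "s \<in> S" "q a = s + (\<Sum>i\<in>J. c i *\<^sub>R q i)" unfolding W_def by blast
      define b where "b = (\<lambda>i. - c i)(a := 1)"
      have "(\<Sum>i\<in>insert a J. b i *\<^sub>R q i) = q a - (\<Sum>i\<in>J. c i *\<^sub>R q i)"
        using insert.hyps upd[of "\<lambda>i. - c i" 1] by (simp add: b_def sum_negf)
      also have "\<dots> = s" using *(2) by simp
      finally show ?thesis using * by (intro disjI1 exI[of _ b] exI[of _ a]) (auto simp: b_def)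
    next
      case dim
      have "insert (q a) (W J) \<subseteq> W (insert a J)"
      proof (intro insert_subsetI subsetI)
        show "q a \<in> W (insert a J)"
          unfolding W_def using subspace_0[OF S] insert.hyps upd[of "\<lambda>_. 0" 1]
          by (intro CollectI exI[of _ 0] exI[of _ "(\<lambda>_. 0)(a := 1)"]) auto
      next
        fix x assume "x \<in> W J"
        then obtain s c where *: "s \<in> S" "x = s + (\<Sum>i\<in>J. c i *\<^sub>R q i)" unfolding W_def by blast
        then show "x \<in> W (insert a J)"
          unfolding W_def using insert.hyps upd[of c 0]
          by (intro CollectI exI[of _ s] exI[of _ "c(a := 0)"]) auto
      qed
      then have "dim (insert (q a) (W J)) \<le> dim (W (insert a J))" by (rule dim_subset)
      moreover have "q a \<notin> span (W J)" using dim(2) sub by (simp add: span_eq_iff[THEN iffD2])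
      ultimately show ?thesis using dim(1) insert.hyps by (simp add: dim_insert)
    qed
  qed
  from this[OF assms(2)] show ?thesis
    using that assms(3) dim_subset_UNIV[of "W I"] by fastforce
qed

text \<open>Rounding within one parity class doubles the usual error 1/2.\<close>

lemma parity_approx:
  fixes x :: real
  obtains k :: int where "odd k \<longleftrightarrow> b" "\<bar>of_int k - x\<bar> \<le> 1"
proof -
  define t :: real where "t = (if b then 1 else 0)"
  define k where "k = 2 * round ((x - t) / 2) + (if b then 1 else 0)"
  have "\<bar>of_int (round ((x - t) / 2)) - (x - t) / 2\<bar> \<le> 1 / 2" by (rule of_int_round_abs_le)
  moreover have "real_of_int k - x = 2 * (of_int (round ((x - t) / 2)) - (x - t) / 2)"
    by (simp add: k_def t_def field_simps)
  ultimately have "\<bar>of_int k - x\<bar> \<le> 1" by (simp only: abs_mult) simp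
  moreover have "odd k \<longleftrightarrow> b" by (simp add: k_def)
  ultimately show ?thesis using that by blast
qed

text \<open>A real relation is scaled by a large \<open>N\<close> and its coefficients are rounded
  to the wanted parities. The resulting error is at most \<open>M\<close>, whatever \<open>N\<close>
  is, and is absorbed by changing \<open>q k\<close> alone, where it gets divided by the large
  coefficient \<open>v k\<close>.\<close>

lemma odd_relation_dense:
  fixes q :: "nat \<Rightarrow> 'a::euclidean_space"
  assumes S: "subspace S" and "finite I" and "DIM('a) < dim S + card I" and "e > 0"
  obtains q' and v :: "nat \<Rightarrow> int"
    where "odd (v a)" "\<forall>i\<in>I. i \<noteq> a \<longrightarrow> even (v i)" "(\<Sum>i\<in>I. of_int (v i) *\<^sub>R q' i) \<in> S"
      "\<forall>i. norm (q' i - q i) < e"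
proof -
  obtain c k where c: "k \<in> I" "c k = (1::real)" "(\<Sum>i\<in>I. c i *\<^sub>R q i) \<in> S"
    using linear_relation_mod[OF assms(1-3)] .
  define M where "M = (\<Sum>i\<in>I. norm (q i))"
  have "M \<ge> 0" unfolding M_def by (simp add: sum_nonneg)
  \<comment> \<open>Rounding costs at most 1 and \<open>c k = 1\<close>, so \<open>v k\<close> is at
    least \<open>1 + M / e\<close>: positive, and large enough for a change below
    \<open>e\<close>.\<close>
  define N where "N = 2 + M / e"
  have "\<forall>i. \<exists>m::int. (odd m \<longleftrightarrow> i = a) \<and> \<bar>of_int m - N * c i\<bar> \<le> 1"
    using parity_approx by metis
  then obtain v :: "nat \<Rightarrow> int"
    where v: "\<And>i. odd (v i) \<longleftrightarrow> i = a" "\<And>i. \<bar>of_int (v i) - N * c i\<bar> \<le> 1" by metis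
  have "of_int (v k) \<ge> N - 1" using v(2)[of k] c(2) by (simp add: abs_le_iff)
  moreover have "M / e \<ge> 0" using \<open>M \<ge> 0\<close> \<open>e > 0\<close> by simp
  ultimately have vk: "real_of_int (v k) > 0" "real_of_int (v k) > M / e"
    by (simp_all add: N_def)
  define s where "s = N *\<^sub>R (\<Sum>i\<in>I. c i *\<^sub>R q i)"
  have "s \<in> S" unfolding s_def using c S by (simp add: subspace_scale)
  define x where "x = (\<Sum>i\<in>I. of_int (v i) *\<^sub>R q i) - s"
  have "x = (\<Sum>i\<in>I. (of_int (v i) - N * c i) *\<^sub>R q i)"
    unfolding x_def s_def by (simp add: scaleR_sum_right scaleR_diff_left sum_subtractf)
  then have "norm x \<le> (\<Sum>i\<in>I. norm ((of_int (v i) - N * c i) *\<^sub>R q i))" by (simp only: norm_sum)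
  also have "\<dots> \<le> M" unfolding M_def
  proof (rule sum_mono)
    fix i
    show "norm ((of_int (v i) - N * c i) *\<^sub>R q i) \<le> norm (q i)"
      using v(2)[of i] by (simp add: mult_left_le_one_le)
  qed
  finally have "norm x \<le> M" .
  define q' where "q' = q(k := q k - (1 / of_int (v k)) *\<^sub>R x)"
  have "(\<Sum>i\<in>I. of_int (v i) *\<^sub>R q' i) = (\<Sum>i\<in>I. of_int (v i) *\<^sub>R q i - (if i = k then x else 0))"
    using vk by (intro sum.cong) (auto simp: q'_def algebra_simps)
  also have "\<dots> = s" using c(1) assms(2) by (simp add: sum_subtractf x_def)
  finally have "(\<Sum>i\<in>I. of_int (v i) *\<^sub>R q' i) \<in> S" using \<open>s \<in> S\<close> by simp
  moreover have "norm (q' i - q i) < e" for i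
  proof -
    have "norm x / of_int (v k) \<le> M / of_int (v k)"
      using vk \<open>norm x \<le> M\<close> by (simp add: divide_right_mono)
    also have "\<dots> < e" using vk \<open>e > 0\<close> by (simp add: field_simps)
    finally show ?thesis using \<open>e > 0\<close> vk by (simp add: q'_def)
  qed
  ultimately show ?thesis using that v(1) by blast
qed

text \<open>Induction on the number of vectors: a vector of the family that is short modulo \<open>S\<close> is
  moved into the subspace, which lowers the codimension; afterwards multiples of it correct the
  remaining vectors. This reaches the targets whose \<open>a\<close>-th vector is in \<open>S\<close>, and the orbits of
  these targets are dense.\<close>

lemma dense_mod_imp_approx_mod:
  fixes p q :: "nat \<Rightarrow> 'a::euclidean_space"
  assumes "finite I" "subspace S" "DIM('a) < dim S + card I" "dense_mod I S p"
  shows "approx_mod I S p q"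
  using assms
proof (induction "card I" arbitrary: I S p q)
  case 0
  then show ?case using dim_subset_UNIV[of S] by simp
next
  case (Suc n I S p q)
  note I = \<open>finite I\<close> and S = \<open>subspace S\<close>
  show ?case
  proof (cases "S = UNIV")
    case True
    have "\<exists>s\<in>S. norm (p i - q i - s) < e" if "e > 0" for e i
      using that by (intro bexI[of _ "p i - q i"]) (auto simp: True)
    then show ?thesis unfolding approx_mod_def by (meson rtranclp.rtrancl_refl)
  next
    case False
    obtain a where a: "a \<in> I" using Suc.hyps(2) by (metis card.empty ex_in_conv nat.simps(3))
    have cod1: "approx_mod I S p r" if "r a \<in> S" for r
      unfolding approx_mod_def
    proof (intro allI impI)
      fix e :: real assume "e > 0"
      obtain v s where v: "odd (v a)" "\<forall>i\<in>I. i \<noteq> a \<longrightarrow> even (v i)" "s \<in> S"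
          and small: "norm ((\<Sum>i\<in>I. of_int (v i) *\<^sub>R p i) - s) < e / 2"
          and notin: "(\<Sum>i\<in>I. of_int (v i) *\<^sub>R p i) \<notin> S"
        using dense_mod_odd_combination[OF Suc.prems(4) S False I a half_gt_zero[OF \<open>e > 0\<close>]] .
      obtain p' g where p': "(shear I)\<^sup>*\<^sup>* p p'" and g: "g \<noteq> 0"
          "of_int g *\<^sub>R p' a = (\<Sum>i\<in>I. of_int (v i) *\<^sub>R p i)"
        using shears_collect_combination[OF I a v(1,2)] .
      have "p' a \<notin> S" using g notin S by (metis subspace_scale)
      \<comment> \<open>This splits \<open>p' a\<close> as \<open>u + w\<close> with
        \<open>u\<close> in \<open>S\<close>; dividing by the nonzero integer \<open>g\<close>
        cannot lengthen the remainder \<open>w\<close>.\<close>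
      define u where "u = (1 / of_int g) *\<^sub>R s"
      define w where "w = p' a - u"
      have "u \<in> S" unfolding u_def using v S by (simp add: subspace_scale)
      have "of_int g *\<^sub>R w = (\<Sum>i\<in>I. of_int (v i) *\<^sub>R p i) - s"
        using g by (simp add: w_def u_def algebra_simps)
      then have "\<bar>of_int g\<bar> * norm w < e / 2" using small by (metis norm_scaleR)
      moreover have "1 * norm w \<le> \<bar>of_int g\<bar> * norm w"
        using g(1) by (intro mult_right_mono) auto
      ultimately have w: "norm w < e / 2" by linarith
      \<comment> \<open>One vector leaves the family and one dimension enters the subspace, so the
        inequality between them persists. Density persists too, since multiples of
        \<open>p' a\<close> are absorbed by \<open>T\<close>.\<close>
      define T where "T = span (insert (p' a) S)"
      have "finite (I - {a})" "n = card (I - {a})" using I a Suc.hyps(2) by auto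
      moreover have "dim T = dim S + 1"
        using \<open>p' a \<notin> S\<close> S by (simp add: T_def dim_insert span_eq_iff[THEN iffD2])
      moreover have "dense_mod (I - {a}) T p'"
        unfolding dense_mod_def
      proof (intro allI impI)
        fix x and f :: real assume "f > 0"
        then obtain v :: "nat \<Rightarrow> int" and s where s: "s \<in> S"
            "norm ((\<Sum>i\<in>I. of_int (v i) *\<^sub>R p' i) + s - x) < f"
          using dense_mod_shears[OF p' Suc.prems(4) I] unfolding dense_mod_def by blast
        have "of_int (v a) *\<^sub>R p' a + s \<in> T"
          unfolding T_def using s by (intro span_add span_scale span_base) auto
        moreover have "(\<Sum>i\<in>I. of_int (v i) *\<^sub>R p' i) + s
            = (\<Sum>i\<in>I - {a}. of_int (v i) *\<^sub>R p' i) + (of_int (v a) *\<^sub>R p' a + s)"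
          using I a by (simp add: sum.remove)
        ultimately show "\<exists>v::nat \<Rightarrow> int. \<exists>s\<in>T.
            norm ((\<Sum>i\<in>I - {a}. of_int (v i) *\<^sub>R p' i) + s - x) < f"
          using s(2) by metis
      qed
      ultimately have "approx_mod (I - {a}) T p' r"
        using Suc.hyps(1)[of "I - {a}" T p' r] Suc.prems(3) Suc.hyps(2) by (simp add: T_def)
      then obtain p'' where p'': "(shear (I - {a}))\<^sup>*\<^sup>* p' p''"
          "\<forall>i\<in>I - {a}. \<exists>t\<in>T. norm (p'' i - r i - t) < e / 2"
        using half_gt_zero[OF \<open>e > 0\<close>] unfolding approx_mod_def by blast
      have p''a: "p'' a = p' a" using shears_unchanged[OF p''(1)] by simp
      have "\<forall>i\<in>I - {a}. \<exists>c. \<exists>t\<in>S. norm (p'' i - r i - (c *\<^sub>R p' a + t)) < e / 2"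
      proof
        fix i assume "i \<in> I - {a}"
        then obtain t where t: "t \<in> T" "norm (p'' i - r i - t) < e / 2" using p'' by blast
        then obtain c where "t - c *\<^sub>R p' a \<in> span S"
          unfolding T_def by (metis span_breakdown_eq)
        then have "t - c *\<^sub>R p' a \<in> S" using S by (simp add: span_eq_iff[THEN iffD2])
        then show "\<exists>c. \<exists>t\<in>S. norm (p'' i - r i - (c *\<^sub>R p' a + t)) < e / 2"
          using t(2) by (intro exI[of _ c] bexI[of _ "t - c *\<^sub>R p' a"]) auto
      qed
      then obtain c t where ct: "\<And>i. i \<in> I - {a} \<Longrightarrow> t i \<in> S"
          "\<And>i. i \<in> I - {a} \<Longrightarrow> norm (p'' i - r i - (c i *\<^sub>R p' a + t i)) < e / 2"
        by metis
      \<comment> \<open>The induction leaves real multiples \<open>c i\<close> of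
        \<open>p' a\<close> to be removed, but only even integers are available. The remaining
        multiple \<open>h\<close> satisfies \<open>\<bar>h\<bar> \<le> 1\<close>, and
        \<open>h *\<^sub>R p' a\<close> is \<open>h *\<^sub>R u\<close>, which lies in
        \<open>S\<close>, plus the short \<open>h *\<^sub>R w\<close>.\<close>
      define m where "m i = - round (c i / 2)" for i
      define z where "z = (\<lambda>i. if i \<in> I - {a} then p'' i + of_int (2 * m i) *\<^sub>R p'' a else p'' i)"
      have "(shear I)\<^sup>*\<^sup>* p'' z"
        unfolding z_def using I a by (intro shears_along) auto
      then have "(shear I)\<^sup>*\<^sup>* p z"
        using p' shears_mono[OF p''(1), of I] by (meson Diff_subset rtranclp_trans)
      moreover have "\<exists>s\<in>S. norm (z i - r i - s) < e" if i: "i \<in> I" for i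
      proof (cases "i = a")
        case True
        \<comment> \<open>Position \<open>a\<close> can no longer be adjusted; it is correct modulo
          \<open>S\<close> up to \<open>w\<close> because \<open>r a\<close> lies in
          \<open>S\<close>.\<close>
        have "z i - r i - (u - r a) = w" by (simp add: z_def True p''a w_def)
        moreover have "u - r a \<in> S" using S \<open>u \<in> S\<close> \<open>r a \<in> S\<close> by (simp add: subspace_diff)
        moreover have "norm w < e" using w \<open>e > 0\<close> by simp
        ultimately show ?thesis by metis
      next
        case False
        define h where "h = c i + of_int (2 * m i)"
        have "\<bar>of_int (round (c i / 2)) - c i / 2\<bar> \<le> 1 / 2" by (rule of_int_round_abs_le)
        then have "\<bar>h\<bar> \<le> 1" unfolding h_def m_def by (simp add: abs_le_iff field_simps)
        have "z i - r i - (t i + h *\<^sub>R u) = (p'' i - r i - (c i *\<^sub>R p' a + t i)) + h *\<^sub>R w"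
          using False i by (simp add: z_def p''a w_def h_def algebra_simps)
        then have "norm (z i - r i - (t i + h *\<^sub>R u))
            \<le> norm (p'' i - r i - (c i *\<^sub>R p' a + t i)) + \<bar>h\<bar> * norm w"
          by (metis norm_scaleR norm_triangle_ineq)
        also have "\<bar>h\<bar> * norm w \<le> norm w" using \<open>\<bar>h\<bar> \<le> 1\<close> by (simp add: mult_left_le_one_le)
        finally have "norm (z i - r i - (t i + h *\<^sub>R u)) < e"
          using ct(2)[of i] w False i by simp
        moreover have "t i + h *\<^sub>R u \<in> S"
          using ct(1)[of i] False i S \<open>u \<in> S\<close> by (simp add: subspace_add subspace_scale)
        ultimately show ?thesis by blast
      qed
      ultimately show "\<exists>p'. (shear I)\<^sup>*\<^sup>* p p' \<and> (\<forall>i\<in>I. \<exists>s\<in>S. norm (p' i - r i - s) < e)"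
        by blast
    qed
    show ?thesis
    proof (rule approx_mod_closed)
      fix e :: real assume "e > 0"
      obtain q' and v :: "nat \<Rightarrow> int"
        where v: "odd (v a)" "\<forall>i\<in>I. i \<noteq> a \<longrightarrow> even (v i)" "(\<Sum>i\<in>I. of_int (v i) *\<^sub>R q' i) \<in> S"
          and q': "\<forall>i. norm (q' i - q i) < e"
        using odd_relation_dense[OF S I Suc.prems(3) \<open>e > 0\<close>] .
      \<comment> \<open>Collecting is now applied to the target: the relation becomes a nonzero
        multiple of \<open>r a\<close>, which puts \<open>r a\<close> in \<open>S\<close>.\<close>
      obtain r g where r: "(shear I)\<^sup>*\<^sup>* q' r" "g \<noteq> 0"
          "of_int g *\<^sub>R r a = (\<Sum>i\<in>I. of_int (v i) *\<^sub>R q' i)"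
        using shears_collect_combination[OF I a v(1,2)] .
      have "r a = (1 / of_int g) *\<^sub>R (of_int g *\<^sub>R r a)" using r(2) by simp
      then have "r a \<in> S" using v(3) S unfolding r(3) by (metis subspace_scale)
      then have "approx_mod I S p q'" using approx_mod_pullback[OF S r(1)] cod1 by blast
      then show "\<exists>q'. approx_mod I S p q' \<and> (\<forall>i\<in>I. norm (q' i - q i) < e)" using q' by blast
    qed
  qed
qed

section \<open>Number of generators of a dense group\<close>

text \<open>With too few generators, density would force their values to form a basis. A linear
  functional equal to 1 on this basis is integral on the group, so it keeps the group away from a
  point where it takes the value 1/2.\<close>

lemma dense_mod_imp_card:
  fixes p :: "nat \<Rightarrow> 'a::euclidean_space"
  assumes "finite I" and dense: "dense_mod I {0} p"
  shows "DIM('a) < card I"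
proof (rule ccontr)
  assume "\<not> DIM('a) < card I"
  then have card: "card (p ` I) \<le> DIM('a)" using card_image_le[OF assms(1), of p] by linarith
  have comb: "(\<Sum>i\<in>I. of_int (v i) *\<^sub>R p i) \<in> span (p ` I)" for v :: "nat \<Rightarrow> int"
    by (intro span_sum span_scale span_base) auto
  have "x \<in> closure (span (p ` I))" for x
    using dense comb unfolding closure_approachable dense_mod_def dist_norm
    by (metis add.right_neutral singletonD)
  then have sp: "UNIV \<subseteq> span (p ` I)" by (metis closed_span closure_closed subsetI)
  then have "independent (p ` I)"
    using card by (intro card_le_dim_spanning[of _ UNIV]) (auto simp: assms(1))
  then obtain f :: "'a \<Rightarrow> real" where f: "linear f" "\<forall>x\<in>p ` I. f x = 1"
    using linear_independent_extend[of "p ` I" "\<lambda>_. 1"] by blast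
  obtain B where B: "B > 0" "\<And>x. norm (f x) \<le> B * norm x"
    using linear_bounded_pos[OF f(1)] by blast
  have "I \<noteq> {}"
  proof
    assume "I = {}"
    then have "DIM('a) = 0" using sp by (metis dim_UNIV dim_empty dim_span image_empty top.extremum_unique)
    then show False by simp
  qed
  then obtain k where k: "k \<in> I" by blast
  define x where "x = (1/2) *\<^sub>R p k"
  have "f x = 1 / 2" using f k by (simp add: x_def linear_scale)
  have "1 / (2 * B) > 0" using B by simp
  then obtain v :: "nat \<Rightarrow> int" where "norm ((\<Sum>i\<in>I. of_int (v i) *\<^sub>R p i) - x) < 1 / (2 * B)"
    using dense unfolding dense_mod_def by fastforce
  then have "B * norm ((\<Sum>i\<in>I. of_int (v i) *\<^sub>R p i) - x) < 1 / 2" using B by (simp add: field_simps)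
  then have "norm (f ((\<Sum>i\<in>I. of_int (v i) *\<^sub>R p i) - x)) < 1 / 2" using B(2) order_le_less_trans by blast
  also have "f ((\<Sum>i\<in>I. of_int (v i) *\<^sub>R p i) - x) = of_int (\<Sum>i\<in>I. v i) - 1 / 2"
    using f \<open>f x = 1 / 2\<close> by (simp add: linear_diff linear_sum linear_scale)
  finally have "\<bar>2 * real_of_int (\<Sum>i\<in>I. v i) - 1\<bar> < 1" by (simp del: of_int_sum add: abs_if split: if_splits)
  then have "\<bar>2 * (\<Sum>i\<in>I. v i) - 1\<bar> < 1" by linarith
  then show False by presburger
qed

section \<open>Legal moves\<close>

text \<open>Reflecting in \<open>p l\<close> and then in \<open>p k\<close> is the translation by
  \<open>2 *\<^sub>R (p k - p l)\<close>. The pairs \<open>j, 0\<close> and \<open>0, j\<close>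
  provide both signs of \<open>c\<close>.\<close>

lemma reachable_translate:
  fixes p :: "nat \<Rightarrow> real ^ 'd" and c :: int
  assumes "i \<le> n" "j \<le> n" "i \<noteq> j" "i \<noteq> 0"
  shows "reachable n p (p(i := p i + of_int (2 * c) *\<^sub>R (p j - p 0)))"
proof -
  have two: "reachable n p (p(i := p i + 2 *\<^sub>R (p k - p l)))"
    if "k \<le> n" "l \<le> n" "i \<noteq> k" "i \<noteq> l" for p :: "nat \<Rightarrow> real ^ 'd" and k l
  proof -
    define r where "r = p(i := 2 *\<^sub>R p l - p i)"
    have "legal_move n p r" unfolding legal_move_def r_def using that assms by force
    moreover have "p(i := p i + 2 *\<^sub>R (p k - p l)) = r(i := 2 *\<^sub>R r k - r i)"
      using that by (auto simp: r_def fun_eq_iff algebra_simps)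
    then have "legal_move n r (p(i := p i + 2 *\<^sub>R (p k - p l)))"
      unfolding legal_move_def using that assms by force
    ultimately show ?thesis unfolding reachable_def by auto
  qed
  have nat_times: "reachable n p (p(i := p i + of_nat (2 * m) *\<^sub>R (p k - p l)))"
    if "k \<le> n" "l \<le> n" "i \<noteq> k" "i \<noteq> l" for k l m
  proof (induction m)
    case 0
    then show ?case by (simp add: reachable_def)
  next
    case (Suc m)
    let ?r = "p(i := p i + of_nat (2 * m) *\<^sub>R (p k - p l))"
    have "p(i := p i + of_nat (2 * Suc m) *\<^sub>R (p k - p l)) = ?r(i := ?r i + 2 *\<^sub>R (?r k - ?r l))"
      using that by (auto simp: fun_eq_iff algebra_simps)
    then show ?case using Suc two[OF that, of ?r] unfolding reachable_def
      by (metis rtranclp_trans)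
  qed
  show ?thesis
  proof (cases "c \<ge> 0")
    case True
    then show ?thesis using nat_times[of j 0 "nat c"] assms by simp
  next
    case False
    then have "of_int (2 * c) *\<^sub>R (p j - p 0) = of_nat (2 * nat (- c)) *\<^sub>R (p 0 - p j)"
      by (simp add: algebra_simps)
    then show ?thesis using nat_times[of 0 j "nat (- c)"] assms by simp
  qed
qed

text \<open>Vectors are measured from particle 0, wherever it is, so that this applies again once
  that particle has left the origin.\<close>

lemma reachable_shears:
  fixes p :: "nat \<Rightarrow> real ^ 'd"
  assumes "(shear {1..n})\<^sup>*\<^sup>* (\<lambda>i. p i - p 0) u"
  shows "\<exists>p'. reachable n p p' \<and> p' 0 = p 0 \<and> (\<forall>i. p' i = p 0 + u i)"
  using assms
proof (induction rule: rtranclp_induct)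
  case base
  then show ?case by (intro exI[of _ p]) (auto simp: reachable_def)
next
  case (step u w)
  then obtain p' where p': "reachable n p p'" "p' 0 = p 0" "\<forall>i. p' i = p 0 + u i" by blast
  obtain i j c where ij: "i \<in> {1..n}" "j \<in> {1..n}" "i \<noteq> j" "w = u(i := u i + of_int (2 * c) *\<^sub>R u j)"
    using step.hyps(2) unfolding shear_def by blast
  let ?r = "p'(i := p' i + of_int (2 * c) *\<^sub>R (p' j - p' 0))"
  have "reachable n p' ?r" using ij by (intro reachable_translate) auto
  then have "reachable n p ?r" using p'(1) unfolding reachable_def by simp
  moreover have "?r k = p 0 + w k" for k using p'(3) ij p'(2) by simp
  moreover have "?r 0 = p 0" using ij p'(2) by simp
  ultimately show ?case by blast
qed

lemma reachable_mem_G: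
  assumes "reachable n p p'" "p 0 = 0" "i \<le> n"
  shows "p' i \<in> G n p"
  using assms(1,3) unfolding reachable_def
proof (induction arbitrary: i rule: rtranclp_induct)
  case base
  then show ?case using assms(2) unfolding G_def
    by (cases "i = 0") (auto intro: group_closure.base)
next
  case (step y z)
  then obtain k l where kl: "k \<le> n" "l \<le> n" "z = y(k := 2 *\<^sub>R y l - y k)"
    unfolding legal_move_def by auto
  have "(y l - y k) + y l \<in> G n p"
    using step.IH kl unfolding G_def by (intro group_closure_add group_closure.diff) auto
  then show ?case using kl step.IH[OF step.prems] by (simp add: scaleR_2 algebra_simps)
qed

text \<open>Shears fix particle 0. It is placed by bringing particle 1 near \<open>q 0 / 2\<close> and reflecting
  particle 0, then at the origin, in it; the other particles are placed afterwards.\<close>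

lemma dense_imp_rich:
  fixes p :: "nat \<Rightarrow> real ^ 'd"
  assumes "n > 0" "p 0 = 0" and dense: "dense_mod {1..n} {0} p"
  shows "rich n p"
  unfolding rich_def
proof (intro allI impI)
  fix q :: "nat \<Rightarrow> real ^ 'd" and e :: real assume "e > 0"
  have approx: "\<exists>u'. (shear {1..n})\<^sup>*\<^sup>* u u' \<and> (\<forall>i\<in>{1..n}. norm (u' i - r i) < f)"
    if "dense_mod {1..n} {0} u" "f > 0" for u r :: "nat \<Rightarrow> real ^ 'd" and f
    using dense_mod_imp_approx_mod[OF _ _ _ that(1), of r] dense_mod_imp_card[OF _ that(1)] that(2)
    by (auto simp: approx_mod_def)
  \<comment> \<open>Reflection doubles \<open>e / 4\<close> to \<open>e / 2\<close> for particle 0.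
    The other particles inherit this error, which leaves \<open>e / 2\<close> for placing
    them.\<close>
  obtain u where u: "(shear {1..n})\<^sup>*\<^sup>* p u" "\<forall>i\<in>{1..n}. norm (u i - (1/2) *\<^sub>R q 0) < e / 4"
    using approx[OF dense, of "e / 4" "\<lambda>_. (1/2) *\<^sub>R q 0"] \<open>e > 0\<close> by auto
  then obtain p1 where p1: "reachable n p p1" "p1 0 = 0" "\<And>i. p1 i = u i"
    using reachable_shears[of n p u] assms(2) by auto
  define p2 where "p2 = p1(0 := 2 *\<^sub>R u 1)"
  have "legal_move n p1 p2"
    unfolding legal_move_def p2_def using assms(1) p1(2,3)
    by (intro bexI[of _ 0] bexI[of _ 1]) auto
  then have r2: "reachable n p p2" using p1(1) unfolding reachable_def by auto
  have "dense_mod {1..n} {0} (\<lambda>i. p2 i - p2 0)"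
    unfolding dense_mod_def
  proof (intro allI impI)
    fix x :: "real ^ 'd" and f :: real assume "f > 0"
    then obtain v :: "nat \<Rightarrow> int" where v: "norm ((\<Sum>i\<in>{1..n}. of_int (v i) *\<^sub>R u i) - x) < f"
      using dense_mod_shears[OF u(1) dense] unfolding dense_mod_def by auto
    \<comment> \<open>Seen from the new particle 0 the vectors are
      \<open>u i - 2 *\<^sub>R u 1\<close>, which is \<open>- u 1\<close> for \<open>i = 1\<close>.
      The loss of \<open>2 * s\<close> copies of \<open>u 1\<close> is repaired by lowering the
      coefficient at 1 by \<open>2 * s\<close>.\<close>
    define s where "s = (\<Sum>i\<in>{1..n}. v i)"
    define w where "w i = v i - (if i = 1 then 2 * s else 0)" for i
    have "(\<Sum>i\<in>{1..n}. of_int (w i) *\<^sub>R (p2 i - p2 0))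
        = (\<Sum>i\<in>{1..n}. of_int (v i) *\<^sub>R u i - of_int (v i) *\<^sub>R (2 *\<^sub>R u 1) +
            (if i = 1 then of_int (2 * s) *\<^sub>R u 1 else 0))"
      by (intro sum.cong) (auto simp: w_def p2_def p1(3) algebra_simps scaleR_2)
    also have "\<dots> = (\<Sum>i\<in>{1..n}. of_int (v i) *\<^sub>R u i) - of_int s *\<^sub>R (2 *\<^sub>R u 1) + of_int (2 * s) *\<^sub>R u 1"
      using assms(1)
      by (simp only: sum.distrib sum_subtractf scaleR_sum_left[symmetric] s_def of_int_sum) simp
    also have "\<dots> = (\<Sum>i\<in>{1..n}. of_int (v i) *\<^sub>R u i)" by (simp add: algebra_simps)
    finally show "\<exists>v::nat \<Rightarrow> int. \<exists>s\<in>{0}. norm ((\<Sum>i\<in>{1..n}. of_int (v i) *\<^sub>R (p2 i - p2 0)) + s - x) < f"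
      using v by (intro exI[of _ w]) simp
  qed
  from approx[OF this, of "e / 2" "\<lambda>i. q i - q 0"] \<open>e > 0\<close>
  obtain w where w: "(shear {1..n})\<^sup>*\<^sup>* (\<lambda>i. p2 i - p2 0) w"
      "\<forall>i\<in>{1..n}. norm (w i - (q i - q 0)) < e / 2" by auto
  obtain p3 where p3: "reachable n p2 p3" "p3 0 = p2 0" "\<And>i. p3 i = p2 0 + w i"
    using reachable_shears[OF w(1)] by blast
  have "p2 0 - q 0 = 2 *\<^sub>R (u 1 - (1/2) *\<^sub>R q 0)" by (simp add: p2_def algebra_simps)
  then have "norm (p2 0 - q 0) = 2 * norm (u 1 - (1/2) *\<^sub>R q 0)" by (metis norm_scaleR abs_numeral)
  then have near0: "norm (p2 0 - q 0) < e / 2" using u(2) assms(1) by force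
  have "dist (p3 i) (q i) \<le> e" if "i \<in> {0..n}" for i
  proof (cases "i = 0")
    case True
    then show ?thesis using near0 p3(2) \<open>e > 0\<close> by (simp add: dist_norm)
  next
    case False
    then have "norm (w i - (q i - q 0)) < e / 2" using w(2) that by simp
    moreover have "p3 i - q i = (p2 0 - q 0) + (w i - (q i - q 0))" using p3(3) by simp
    ultimately have "norm (p3 i - q i) < e / 2 + e / 2"
      using near0 by (metis add_strict_mono norm_triangle_ineq order_le_less_trans)
    then show ?thesis by (simp add: dist_norm)
  qed
  moreover have "reachable n p p3" using r2 p3(1) unfolding reachable_def by simp
  ultimately show "\<exists>p'. reachable n p p' \<and> (\<forall>i\<in>{0..n}. dist (p' i) (q i) \<le> e)" by blast
qed

theorem theorem1p2:
  fixes n :: nat and p :: "nat \<Rightarrow> real ^ 'd"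
  assumes "n > 0" and "p 0 = 0"
  shows "rich n p \<longleftrightarrow> closure (G n p) = UNIV"
proof
  assume rich: "rich n p"
  have "x \<in> closure (G n p)" for x
    unfolding closure_approachable
  proof (intro allI impI)
    fix e :: real assume "e > 0"
    \<comment> \<open>All particles are sent to \<open>x\<close>, and particle 0 then serves as the
      witness in the group; \<open>e / 2\<close> turns the weak inequality into a strict
      one.\<close>
    then have "e / 2 > 0" by simp
    then obtain p' where "reachable n p p'" "\<forall>i\<in>{0..n}. dist (p' i) x \<le> e / 2"
      using rich[unfolded rich_def, rule_format, of "e / 2" "\<lambda>_. x"] by blast
    then have "p' 0 \<in> G n p" "dist (p' 0) x < e"
      using reachable_mem_G assms \<open>e > 0\<close> by force+
    then show "\<exists>y\<in>G n p. dist y x < e" by blast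
  qed
  then show "closure (G n p) = UNIV" by blast
next
  assume dense: "closure (G n p) = UNIV"
  have "dense_mod {1..n} {0} p"
    unfolding dense_mod_def
  proof (intro allI impI)
    fix x :: "real ^ 'd" and e :: real assume "e > 0"
    then obtain y where "y \<in> G n p" "dist y x < e"
      using dense closure_approachable by (metis UNIV_I)
    then show "\<exists>v::nat \<Rightarrow> int. \<exists>s\<in>{0}. norm ((\<Sum>i\<in>{1..n}. of_int (v i) *\<^sub>R p i) + s - x) < e"
      unfolding G_eq_integer_combinations by (auto simp: dist_norm)
  qed
  then show "rich n p" using dense_imp_rich assms by blast
qed

end
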